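(* Assume treatment ignorability, latent principal ignorability and the odds-ratio (non-monotonicity) assumption (all stated in the context). Fix $s\in\{11,10,01,00\}$, and for $z\in\{0,1\}$ let $d=d_z$ be the value with $s\in\mathcal S_{z,d_z}$. Suppose the value of $\Delta_s(x)$ under mean principal ignorability, $m_{1,d_1}(x)-m_{0,d_0}(x)$, is positive, and that the worst-case lower bound crosses the null: $\lim_{\Lambda\to\infty}\{L_{1,s}(x,\Lambda)-U_{0,s}(x,\Lambda)\}\le 0$. Let $\Lambda_s^*(x)$ be the critical falsification threshold, i.e. the unique real root $\Lambda\in(1,\infty)$ of $L_{1,s}(x,\Lambda)-U_{0,s}(x,\Lambda)=0$. Then, in order to generate a confounding magnitude sufficient to nullify $\Delta_s(x)$ (that is, for the lower bound to satisfy $L_{1,s}(x,\mathrm{BF}_U^{1,d_1}(x))-U_{0,s}(x,\mathrm{BF}_U^{0,d_0}(x))\le 0$), the unmeasured confounder $U$ must satisfy, for at least one treatment arm $z\in\{0,1\}$, both $$\min\left\{\mathrm{RR}_{SU}^{z,d_z}(x),\mathrm{RR}_{UY}^z(x)\right\}\ge\Lambda_s^*(x),$$ $$\max\left\{\mathrm{RR}_{SU}^{z,d_z}(x),\mathrm{RR}_{UY}^z(x)\right\}\ge\Lambda_s^*(x)+\sqrt{\Lambda_s^*(x)\{\Lambda_s^*(x)-1\}}.$$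
   Context: Setup. $Z\in\{0,1\}$ is a treatment, $D(z)\in\{0,1\}$ and $Y(z)\in[0,1]$ are the potential intermediate and final outcomes under $Z=z$, $X\in\mathcal X$ are baseline covariates and $U$ is a set of unmeasured baseline confounders; neither $X$ nor $U$ is affected by $Z$ ($U$ is written as categorical; for general $U$ probability ratios are replaced by Radon–Nikodym derivatives). Observed: $D=ZD(1)+(1-Z)D(0)$, $Y=ZY(1)+(1-Z)Y(0)$ (SUTVA). The principal stratum is $S=(D(1),D(0))\in\{11,10,01,00\}$. Let $e_s(x)=\mathbb P(S=s\mid X=x)$ and $p_z(x)=\mathbb P(D=1\mid Z=z,X=x)$. Assumptions. Treatment ignorability: $Z\perp\{D(0),D(1),Y(0),Y(1)\}\mid X$. Latent principal ignorability: $Y(z)\perp S\mid X,U$ for $z\in\{0,1\}$. Odds-ratio (non-monotonicity) assumption: there is a known function $\theta:\mathcal X\to[0,\infty]$ with $\theta(x)=e_{11}(x)e_{00}(x)/\{e_{10}(x)e_{01}(x)\}$. Since $p_1=e_{11}+e_{10}$, $p_0=e_{11}+e_{01}$ and $\sum_s e_s=1$, the $e_s(x)$ are then determined by $p_1(x),p_0(x),\theta(x)$. Cells. $\mathcal S_{1,1}=\{10,11\}$, $\mathcal S_{0,0}=\{10,00\}$, $\mathcal S_{1,0}=\{00,01\}$, $\mathcal S_{0,1}=\{11,01\}$. For $s\in\mathcal S_{z,d}$, $s'$ denotes the other element of $\mathcal S_{z,d}$. Sensitivity parameters. $\mathrm{RR}_{SU}^{z,d}(x)\in[1,\infty)$ is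 the maximum of $\mathbb P(U=u\mid S=s,X=x)/\mathbb P(U=u\mid S=s',X=x)$ over $u$ and over ordered pairs $s\ne s'$ in $\mathcal S_{z,d}$. $\mathrm{RR}_{UY}^{z}(x)=\max_u\mathbb E\{Y(z)\mid X=x,U=u\}/\min_u\mathbb E\{Y(z)\mid X=x,U=u\}\in[1,\infty)$. $\mathrm{BF}_U^{z,d}(x)=\dfrac{\mathrm{RR}_{SU}^{z,d}(x)\mathrm{RR}_{UY}^z(x)}{\mathrm{RR}_{SU}^{z,d}(x)+\mathrm{RR}_{UY}^z(x)-1}$. Means, weights, bounds. $\mu_{z,s}(x)=\mathbb E\{Y(z)\mid S=s,X=x\}$, $\Delta_s(x)=\mu_{1,s}(x)-\mu_{0,s}(x)$, $m_{z,d}(x)=\mathbb E(Y\mid Z=z,D=d,X=x)$. For $s\in\mathcal S_{z,d}$: $w_{z,s}(x)=e_s(x)/p_z(x)$ if $d=1$ and $w_{z,s}(x)=e_s(x)/\{1-p_z(x)\}$ if $d=0$. For $b\ge1$ put $A(b)=w_{z,s}(x)+\{1-w_{z,s}(x)\}b$, $B(b)=w_{z,s}(x)+\{1-w_{z,s}(x)\}/b$ and $$L_{z,s}(x,b)=\max\left[\frac{m_{z,d}(x)}{A(b)},\,1-\frac{1-m_{z,d}(x)}{B(b)}\right],\qquad U_{z,s}(x,b)=\min\left[\frac{m_{z,d}(x)}{B(b)},\,1-\frac{1-m_{z,d}(x)}{A(b)}\right].$$ The sensitivity lower bound for $\Delta_s(x)$ is $L_{1,s}(x,\mathrm{BF}_U^{1,d_1}(x))-U_{0,s}(x,\mathrm{BF}_U^{0,d_0}(x))$.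 Mean principal ignorability is the condition $\mu_{z,s}(x)=m_{z,d}(x)$ for all $s\in\mathcal S_{z,d}$. *)

theory Defs
  imports "HOL-Probability.Probability"
begin

section \<open>Conditional independence and essential ranges\<close>

definition cond_indep_var ::
  "'a measure \<Rightarrow> 'a measure \<Rightarrow> 'b measure \<Rightarrow> ('a \<Rightarrow> 'b) \<Rightarrow> 'c measure \<Rightarrow> ('a \<Rightarrow> 'c) \<Rightarrow> bool" where
  "cond_indep_var Q F N V N' V' \<longleftrightarrow>
     (\<forall>B\<in>sets N. \<forall>B'\<in>sets N'. AE w in Q.
        real_cond_exp Q F (indicator {w \<in> space Q. V w \<in> B \<and> V' w \<in> B'}) w =
        real_cond_exp Q F (indicator {w \<in> space Q. V w \<in> B}) w *
        real_cond_exp Q F (indicator {w \<in> space Q. V' w \<in> B'}) w)"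

definition essinf :: "'a measure \<Rightarrow> ('a \<Rightarrow> ennreal) \<Rightarrow> ennreal" where
  "essinf Q f = Liminf (ae_filter Q) f"

text \<open>The largest value of the density ratio of \<open>P\<close> with respect to \<open>P'\<close>: the essential supremum
  of the Radon--Nikodym derivative, and infinity if \<open>P\<close> charges a \<open>P'\<close>-null set.  On a countable
  discrete space this is the supremum of the ratios of the point masses, see
  \<open>max_density_ratio_discrete\<close> below.\<close>

definition max_density_ratio :: "'u measure \<Rightarrow> 'u measure \<Rightarrow> ennreal" where
  "max_density_ratio P P' =
     (if absolutely_continuous P' P then esssup P' (RN_deriv P' P) else \<infinity>)"


section \<open>The causal model\<close>

text \<open>The values 0, 1 of treatment and intermediate outcome are \<open>False\<close>, \<open>True\<close>.  The
  potential outcomes take the treatment arm as argument; baseline covariates and confounder do not,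
  as they are not affected by treatment.  \<open>cond_law G x\<close> is the law on the sample space
  given \<open>X = x\<close>.\<close>

record ('a, 'x, 'u) study =
  Pr :: "'a measure"
  treat :: "'a \<Rightarrow> bool"
  pot_D :: "bool \<Rightarrow> 'a \<Rightarrow> bool"
  pot_Y :: "bool \<Rightarrow> 'a \<Rightarrow> real"
  cov_space :: "'x measure"
  cov :: "'a \<Rightarrow> 'x"
  conf_space :: "'u measure"
  conf :: "'a \<Rightarrow> 'u"
  cond_law :: "'x \<Rightarrow> 'a measure"

definition regular_cond_law :: "('a, 'x, 'u) study \<Rightarrow> bool" where
  "regular_cond_law G \<longleftrightarrow>
     cond_law G \<in> cov_space G \<rightarrow>\<^sub>M prob_algebra (Pr G) \<and>
     (\<forall>A\<in>sets (Pr G). \<forall>B\<in>sets (cov_space G).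
        emeasure (Pr G) {w \<in> space (Pr G). w \<in> A \<and> cov G w \<in> B} =
        (\<integral>\<^sup>+x\<in>B. emeasure (cond_law G x) A \<partial>distr (Pr G) (cov_space G) (cov G)))"

definition study_model :: "('a, 'x, 'u) study \<Rightarrow> bool" where
  "study_model G \<longleftrightarrow>
     prob_space (Pr G) \<and>
     treat G \<in> Pr G \<rightarrow>\<^sub>M count_space UNIV \<and>
     (\<forall>z. pot_D G z \<in> Pr G \<rightarrow>\<^sub>M count_space UNIV) \<and>
     (\<forall>z. pot_Y G z \<in> borel_measurable (Pr G)) \<and>
     (\<forall>z. \<forall>w\<in>space (Pr G). 0 \<le> pot_Y G z w \<and> pot_Y G z w \<le> 1) \<and>
     cov G \<in> Pr G \<rightarrow>\<^sub>M cov_space G \<and>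
     conf G \<in> Pr G \<rightarrow>\<^sub>M conf_space G \<and>
     regular_cond_law G"

definition obs_D :: "('a, 'x, 'u) study \<Rightarrow> 'a \<Rightarrow> bool" where
  "obs_D G w = (if treat G w then pot_D G True w else pot_D G False w)"

definition obs_Y :: "('a, 'x, 'u) study \<Rightarrow> 'a \<Rightarrow> real" where
  "obs_Y G w = (if treat G w then pot_Y G True w else pot_Y G False w)"

type_synonym stratum = "bool \<times> bool"

definition stratum_of :: "('a, 'x, 'u) study \<Rightarrow> 'a \<Rightarrow> stratum" where
  "stratum_of G w = (pot_D G True w, pot_D G False w)"

fun cell :: "bool \<Rightarrow> bool \<Rightarrow> stratum set" where
  "cell True True = {(True, False), (True, True)}"
| "cell False False = {(True, False), (False, False)}"
| "cell True False = {(False, False), (False, True)}"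
| "cell False True = {(True, True), (False, True)}"

definition e_strat :: "('a, 'x, 'u) study \<Rightarrow> stratum \<Rightarrow> 'x \<Rightarrow> real" where
  "e_strat G s x = \<P>(w in cond_law G x. stratum_of G w = s)"

definition p_arm :: "('a, 'x, 'u) study \<Rightarrow> bool \<Rightarrow> 'x \<Rightarrow> real" where
  "p_arm G z x = \<P>(w in cond_law G x. obs_D G w \<bar> treat G w = z)"


section \<open>Assumptions, at a covariate value\<close>

text \<open>Independence of the generated sigma-algebras; \<open>indep_var\<close> would require both random
  variables to have the same type.\<close>

definition treatment_ignorability :: "('a, 'x, 'u) study \<Rightarrow> 'x \<Rightarrow> bool" where
  "treatment_ignorability G x \<longleftrightarrow>
     prob_space.indep_set (cond_law G x)
       (sets (vimage_algebra (space (cond_law G x)) (treat G) (count_space UNIV)))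
       (sets (vimage_algebra (space (cond_law G x))
          (\<lambda>w. (pot_D G False w, pot_D G True w, pot_Y G False w, pot_Y G True w))
          (count_space UNIV \<Otimes>\<^sub>M count_space UNIV \<Otimes>\<^sub>M borel \<Otimes>\<^sub>M borel)))"

definition conf_algebra :: "('a, 'x, 'u) study \<Rightarrow> 'x \<Rightarrow> 'a measure" where
  "conf_algebra G x = vimage_algebra (space (cond_law G x)) (conf G) (conf_space G)"

definition latent_principal_ignorability :: "('a, 'x, 'u) study \<Rightarrow> 'x \<Rightarrow> bool" where
  "latent_principal_ignorability G x \<longleftrightarrow>
     (\<forall>z. cond_indep_var (cond_law G x) (conf_algebra G x)
            borel (pot_Y G z) (count_space UNIV) (stratum_of G))"

text \<open>The value infinity (as under monotonicity, \<open>e\<^sub>0\<^sub>1 = 0\<close>) is allowed; 0/0 is 0 by convention.\<close>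

definition odds_ratio_assumption ::
  "('a, 'x, 'u) study \<Rightarrow> ('x \<Rightarrow> ennreal) \<Rightarrow> 'x \<Rightarrow> bool" where
  "odds_ratio_assumption G \<theta> x \<longleftrightarrow>
     \<theta> x = ennreal (e_strat G (True, True) x * e_strat G (False, False) x) /
           ennreal (e_strat G (True, False) x * e_strat G (False, True) x)"


section \<open>Sensitivity parameters\<close>

definition conf_law :: "('a, 'x, 'u) study \<Rightarrow> stratum \<Rightarrow> 'x \<Rightarrow> 'u measure" where
  "conf_law G s x =
     distr (uniform_measure (cond_law G x) {w \<in> space (cond_law G x). stratum_of G w = s})
       (conf_space G) (conf G)"

text \<open>If a stratum of the cell has probability 0 given \<open>X = x\<close>, there is only one stratum left to
  compare and the parameter is 1.\<close>

definition RR_SU :: "('a, 'x, 'u) study \<Rightarrow> bool \<Rightarrow> bool \<Rightarrow> 'x \<Rightarrow> ennreal" where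
  "RR_SU G z d x =
     (if \<exists>s\<in>cell z d. e_strat G s x = 0 then 1
      else SUP (s, s') \<in> {(s, s'). s \<in> cell z d \<and> s' \<in> cell z d \<and> s \<noteq> s'}.
             max_density_ratio (conf_law G s x) (conf_law G s' x))"

definition mean_given_conf :: "('a, 'x, 'u) study \<Rightarrow> bool \<Rightarrow> 'x \<Rightarrow> 'a \<Rightarrow> real" where
  "mean_given_conf G z x = real_cond_exp (cond_law G x) (conf_algebra G x) (pot_Y G z)"

definition RR_UY :: "('a, 'x, 'u) study \<Rightarrow> bool \<Rightarrow> 'x \<Rightarrow> ennreal" where
  "RR_UY G z x =
     esssup (cond_law G x) (\<lambda>w. ennreal (mean_given_conf G z x w)) /
     essinf (cond_law G x) (\<lambda>w. ennreal (mean_given_conf G z x w))"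

definition BF :: "('a, 'x, 'u) study \<Rightarrow> bool \<Rightarrow> bool \<Rightarrow> 'x \<Rightarrow> real" where
  "BF G z d x =
     enn2real (RR_SU G z d x) * enn2real (RR_UY G z x) /
     (enn2real (RR_SU G z d x) + enn2real (RR_UY G z x) - 1)"


section \<open>Means, weights and bounds\<close>

definition mu :: "('a, 'x, 'u) study \<Rightarrow> bool \<Rightarrow> stratum \<Rightarrow> 'x \<Rightarrow> real" where
  "mu G z s x =
     (\<integral>w. pot_Y G z w
        \<partial>uniform_measure (cond_law G x) {w \<in> space (cond_law G x). stratum_of G w = s})"

definition Delta :: "('a, 'x, 'u) study \<Rightarrow> stratum \<Rightarrow> 'x \<Rightarrow> real" where
  "Delta G s x = mu G True s x - mu G False s x"

definition obs_mean :: "('a, 'x, 'u) study \<Rightarrow> bool \<Rightarrow> bool \<Rightarrow> 'x \<Rightarrow> real" where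
  "obs_mean G z d x =
     (\<integral>w. obs_Y G w
        \<partial>uniform_measure (cond_law G x)
          {w \<in> space (cond_law G x). treat G w = z \<and> obs_D G w = d})"

definition mean_principal_ignorability :: "('a, 'x, 'u) study \<Rightarrow> 'x \<Rightarrow> bool" where
  "mean_principal_ignorability G x \<longleftrightarrow>
     (\<forall>z d. \<forall>s\<in>cell z d. mu G z s x = obs_mean G z d x)"

definition weight :: "('a, 'x, 'u) study \<Rightarrow> bool \<Rightarrow> bool \<Rightarrow> stratum \<Rightarrow> 'x \<Rightarrow> real" where
  "weight G z d s x = e_strat G s x / (if d then p_arm G z x else 1 - p_arm G z x)"

definition A_factor :: "real \<Rightarrow> real \<Rightarrow> real" where
  "A_factor w b = w + (1 - w) * b"

definition B_factor :: "real \<Rightarrow> real \<Rightarrow> real" where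
  "B_factor w b = w + (1 - w) / b"

text \<open>In \<open>lower_bd G z d s x b\<close> and \<open>upper_bd G z d s x b\<close>, \<open>d\<close> is the value with
  \<open>s \<in> cell z d\<close>.\<close>

definition lower_bd ::
  "('a, 'x, 'u) study \<Rightarrow> bool \<Rightarrow> bool \<Rightarrow> stratum \<Rightarrow> 'x \<Rightarrow> real \<Rightarrow> real" where
  "lower_bd G z d s x b =
     max (obs_mean G z d x / A_factor (weight G z d s x) b)
         (1 - (1 - obs_mean G z d x) / B_factor (weight G z d s x) b)"

definition upper_bd ::
  "('a, 'x, 'u) study \<Rightarrow> bool \<Rightarrow> bool \<Rightarrow> stratum \<Rightarrow> 'x \<Rightarrow> real \<Rightarrow> real" where
  "upper_bd G z d s x b =
     min (obs_mean G z d x / B_factor (weight G z d s x) b)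
         (1 - (1 - obs_mean G z d x) / A_factor (weight G z d s x) b)"

definition effect_lower_bd ::
  "('a, 'x, 'u) study \<Rightarrow> (bool \<Rightarrow> bool) \<Rightarrow> stratum \<Rightarrow> 'x \<Rightarrow> real \<Rightarrow> real \<Rightarrow> real" where
  "effect_lower_bd G d s x b\<^sub>1 b\<^sub>0 =
     lower_bd G True (d True) s x b\<^sub>1 - upper_bd G False (d False) s x b\<^sub>0"

definition is_threshold ::
  "('a, 'x, 'u) study \<Rightarrow> (bool \<Rightarrow> bool) \<Rightarrow> stratum \<Rightarrow> 'x \<Rightarrow> real \<Rightarrow> bool" where
  "is_threshold G d s x \<Lambda> \<longleftrightarrow> 1 < \<Lambda> \<and> effect_lower_bd G d s x \<Lambda> \<Lambda> = 0"

text \<open>The root need not exist if the effect lower bound tends to 0 from above.\<close>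

definition threshold ::
  "('a, 'x, 'u) study \<Rightarrow> (bool \<Rightarrow> bool) \<Rightarrow> stratum \<Rightarrow> 'x \<Rightarrow> real" where
  "threshold G d s x = (THE \<Lambda>. is_threshold G d s x \<Lambda>)"


section \<open>Elementary forms of the definitions\<close>

lemma Delta_under_mean_principal_ignorability:
  assumes "mean_principal_ignorability G x" "\<And>z. s \<in> cell z (d z)"
  shows "Delta G s x = obs_mean G True (d True) x - obs_mean G False (d False) x"
  using assms(1) assms(2)[of True] assms(2)[of False]
  unfolding Delta_def mean_principal_ignorability_def by metis

lemma mem_cell_iff: "s \<in> cell z d \<longleftrightarrow> d = (if z then fst s else snd s)"
  by (cases s; cases z; cases d) auto

lemma essinf_eq_AE: "essinf Q f = Sup {z. AE w in Q. z \<le> f w}"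
  unfolding essinf_def Liminf_def
proof (intro antisym SUP_least Sup_least; clarsimp)
  fix R assume "AE w in Q. R w"
  then have "AE w in Q. (INF w\<in>Collect R. f w) \<le> f w"
    by (auto elim!: eventually_mono intro: INF_lower)
  then show "(INF w\<in>Collect R. f w) \<le> Sup {z. AE w in Q. z \<le> f w}"
    by (intro Sup_upper) auto
next
  fix z assume "AE w in Q. z \<le> f w"
  then show "z \<le> (SUP R\<in>{R. AE w in Q. R w}. INF w\<in>Collect R. f w)"
    by (intro SUP_upper2[of "\<lambda>w. z \<le> f w"]) (auto intro: INF_greatest)
qed

lemma max_density_ratio_discrete:
  fixes P P' :: "'u::countable measure"
  assumes "prob_space P" "prob_space P'"
    and P: "sets P = UNIV" and P': "sets P' = UNIV"
  shows "max_density_ratio P P' = (SUP u. emeasure P {u} / emeasure P' {u})"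
proof -
  interpret P: prob_space P by fact
  interpret P': prob_space P' by fact
  have [simp]: "space P = UNIV" "space P' = UNIV"
    using P P' by (metis UNIV_I UNIV_eq_I sets.sets_into_space subset_UNIV top.extremum_uniqueI)+
  have ms: "f \<in> borel_measurable P'" for f :: "'u \<Rightarrow> ennreal"
    by (simp add: measurable_def P')
  let ?f = "\<lambda>u. emeasure P {u} / emeasure P' {u}"
  show ?thesis
  proof (cases "absolutely_continuous P' P")
    case True
    have null: "emeasure P {u} = 0" if "emeasure P' {u} = 0" for u
      using True that by (auto simp: absolutely_continuous_def null_sets_def P P')
    have "density P' ?f = P"
    proof (rule measure_eqI_countable[where A = UNIV])
      fix u :: 'u
      have "emeasure (density P' ?f) {u} = (\<integral>\<^sup>+v. ?f u * indicator {u} v \<partial>P')"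
        by (subst emeasure_density)
          (auto simp: ms P' intro!: nn_integral_cong split: split_indicator)
      also have "\<dots> = ?f u * emeasure P' {u}"
        by (subst nn_integral_cmult_indicator) (auto simp: P')
      also have "\<dots> = emeasure P {u}"
      proof (cases "emeasure P' {u} = 0")
        case False
        then have "emeasure P' {u} / emeasure P' {u} = 1"
          by (intro ennreal_divide_self) (auto simp: top.not_eq_extremum[symmetric])
        then show ?thesis by (simp add: ennreal_divide_times)
      qed (simp add: null)
      finally show "emeasure (density P' ?f) {u} = emeasure P {u}" .
    qed (auto simp: P P')
    then have "AE u in P'. ?f u = RN_deriv P' P u"
      by (intro P'.RN_deriv_unique ms)
    then have eq: "esssup P' (RN_deriv P' P) = esssup P' ?f"
      by (intro esssup_AE_cong ms) auto
    have "esssup P' ?f \<le> (SUP u. ?f u)"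
      by (intro esssup_I ms AE_I2 SUP_upper) auto
    moreover have "?f u \<le> esssup P' ?f" for u
    proof (cases "emeasure P' {u} = 0")
      case False
      obtain N where N: "{v. \<not> ?f v \<le> esssup P' ?f} \<subseteq> N" "emeasure P' N = 0"
        using AE_E[OF esssup_AE[where M = P' and f = ?f]] by auto
      then have "u \<notin> N"
        using False emeasure_mono[of "{u}" N P'] by (auto simp: P')
      then show ?thesis using N by auto
    qed (simp add: null)
    ultimately show ?thesis
      using True eq by (auto simp: max_density_ratio_def intro!: antisym SUP_least)
  next
    case False
    then obtain A where A: "emeasure P' A = 0" "emeasure P A \<noteq> 0"
      by (auto simp: absolutely_continuous_def null_sets_def P P')
    have "\<exists>u\<in>A. emeasure P {u} \<noteq> 0"
    proof (rule ccontr)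
      assume "\<not> ?thesis"
      then have "(\<Union>u\<in>A. {u}) \<in> null_sets P"
        by (intro null_sets_UN') (auto simp: P null_sets_def)
      then show False using A by auto
    qed
    then obtain u where u: "u \<in> A" "emeasure P {u} \<noteq> 0" by auto
    moreover have "emeasure P' {u} = 0"
      using A(1) u(1) emeasure_mono[of "{u}" A P'] by (auto simp: P')
    ultimately have "?f u = \<infinity>" by (simp add: ennreal_divide_zero)
    then have "(SUP u. ?f u) = \<infinity>"
      using SUP_upper[of u UNIV ?f] by (simp add: top.extremum_unique)
    then show ?thesis unfolding max_density_ratio_def if_not_P[OF False] by (rule sym)
  qed
qed

lemma real_cond_exp_discrete:
  fixes V :: "'a \<Rightarrow> 'u::countable"
  assumes "prob_space Q" and V: "V \<in> Q \<rightarrow>\<^sub>M count_space UNIV" and f: "integrable Q f"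
  shows "AE w in Q. real_cond_exp Q (vimage_algebra (space Q) V (count_space UNIV)) f w =
           (\<integral>w'. f w' \<partial>uniform_measure Q {w' \<in> space Q. V w' = V w})"
proof -
  interpret Q: prob_space Q by fact
  let ?F = "vimage_algebra (space Q) V (count_space UNIV)"
  have sub: "subalgebra Q ?F"
    using V by (auto simp: subalgebra_def sets_vimage_algebra2 measurable_sets)
  interpret F: finite_measure_subalgebra Q ?F
    by unfold_locales (rule sub)
  let ?h = "\<lambda>u. \<integral>w'. f w' \<partial>uniform_measure Q {w' \<in> space Q. V w' = u}"
  let ?g = "real_cond_exp Q ?F f"
  have VF: "V \<in> ?F \<rightarrow>\<^sub>M count_space UNIV"
    by (intro measurable_vimage_algebra1) auto
  have Em: "{w \<in> space Q. V w = u} \<in> sets ?F" for u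
    using measurable_sets[OF VF, of "{u}"] by (simp add: vimage_def Int_def conj_commute)
  have Em': "{w \<in> space Q. V w = u} \<in> sets Q" for u
    using Em sub by (auto simp: subalgebra_def)
  have const: "?g w = ?g w'" if "w \<in> space Q" "w' \<in> space Q" "V w = V w'" for w w'
  proof -
    have "?g -` {?g w} \<inter> space ?F \<in> sets ?F"
      by (intro measurable_sets[OF borel_measurable_cond_exp]) auto
    then obtain B where B: "?g -` {?g w} \<inter> space Q = V -` B \<inter> space Q"
      by (auto simp: sets_vimage_algebra2)
    moreover have "w \<in> ?g -` {?g w} \<inter> space Q" using that by simp
    ultimately have "w \<in> V -` B" by blast
    then have "w' \<in> V -` B \<inter> space Q" using that by simp
    then have "w' \<in> ?g -` {?g w} \<inter> space Q" unfolding B .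
    then show ?thesis by simp
  qed
  have "AE w in Q. V w = u \<longrightarrow> ?g w = ?h u" for u
  proof (cases "Q.prob {w \<in> space Q. V w = u} = 0")
    case True
    then have "AE w in Q. w \<notin> {w \<in> space Q. V w = u}"
      using Em'[of u] by (intro AE_not_in) (auto simp: null_sets_def Q.emeasure_eq_measure)
    then show ?thesis by (rule AE_mp) (auto intro!: AE_I2)
  next
    case False
    let ?E = "{w \<in> space Q. V w = u}"
    have "?g w = ?h u" if w: "w \<in> ?E" for w
    proof -
      have "(\<integral>v. indicator ?E v * f v \<partial>Q) = (\<integral>v. indicator ?E v * ?g v \<partial>Q)"
        using F.real_cond_exp_intA[OF f Em[of u]] by (simp add: set_lebesgue_integral_def)
      also have "\<dots> = (\<integral>v. indicator ?E v * ?g w \<partial>Q)"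
      proof (intro Bochner_Integration.integral_cong refl)
        fix v assume "v \<in> space Q"
        show "indicator ?E v * ?g v = indicator ?E v * ?g w"
          using w const[of v w] by (cases "v \<in> ?E") simp_all
      qed
      also have "\<dots> = Q.prob ?E * ?g w"
        using Em'[of u] by simp
      finally have "?g w = (\<integral>v. indicator ?E v * f v \<partial>Q) / Q.prob ?E"
        using False by simp
      also have "\<dots> = ?h u"
      proof -
        have "?h u = (\<integral>v. (indicator ?E v / Q.prob ?E) *\<^sub>R f v \<partial>Q)"
        proof -
          have "uniform_measure Q ?E = density Q (\<lambda>v. ennreal (indicator ?E v / Q.prob ?E))"
            unfolding uniform_measure_def
          proof (intro density_cong AE_I2)
            have "0 < Q.prob ?E" using False by (simp add: less_le)
            then show "indicator ?E v / emeasure Q ?E = ennreal (indicator ?E v / Q.prob ?E)" for v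
              by (simp add: Q.emeasure_eq_measure divide_ennreal[symmetric] ennreal_indicator)
          qed (use Em'[of u] in auto)
          then show ?thesis
            using Em'[of u] f by (simp add: integral_density)
        qed
        also have "\<dots> = (\<integral>v. (indicator ?E v * f v) / Q.prob ?E \<partial>Q)"
          by (intro Bochner_Integration.integral_cong) auto
        finally show ?thesis by simp
      qed
      finally show ?thesis .
    qed
    then show ?thesis by (intro AE_I2) auto
  qed
  then have "AE w in Q. \<forall>u. V w = u \<longrightarrow> ?g w = ?h u"
    by (subst AE_all_countable) auto
  then show ?thesis by eventually_elim auto
qed

lemma cond_law_prob:
  assumes "study_model G" "x \<in> space (cov_space G)"
  shows "prob_space (cond_law G x)" "sets (cond_law G x) = sets (Pr G)"
    "space (cond_law G x) = space (Pr G)"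
proof -
  have "cond_law G x \<in> space (prob_algebra (Pr G))"
    using assms by (auto simp: study_model_def regular_cond_law_def intro: measurable_space)
  then show "prob_space (cond_law G x)" and s: "sets (cond_law G x) = sets (Pr G)"
    by (auto simp: space_prob_algebra)
  show "space (cond_law G x) = space (Pr G)" by (rule sets_eq_imp_space_eq[OF s])
qed

lemma stratum_of_measurable:
  assumes "study_model G"
  shows "stratum_of G \<in> Pr G \<rightarrow>\<^sub>M count_space UNIV"
proof -
  have [measurable]: "pot_D G z \<in> Pr G \<rightarrow>\<^sub>M count_space UNIV" for z
    using assms by (auto simp: study_model_def)
  have "(\<lambda>w. (pot_D G True w, pot_D G False w)) \<in> Pr G \<rightarrow>\<^sub>M count_space UNIV \<Otimes>\<^sub>M count_space UNIV"
    by measurable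
  then show ?thesis
    by (simp add: stratum_of_def[abs_def] pair_measure_countable)
qed

text \<open>For a categorical confounder the sensitivity parameters are the extreme ratios of
  elementary conditional probabilities and expectations.\<close>

lemma RR_SU_categorical:
  fixes G :: "('a, 'x, 'u::countable) study"
  assumes G: "study_model G" and x: "x \<in> space (cov_space G)"
    and C: "conf_space G = count_space UNIV"
    and pos: "\<And>s. s \<in> cell z d \<Longrightarrow> 0 < e_strat G s x"
  shows "RR_SU G z d x =
    (SUP (s, s') \<in> {(s, s'). s \<in> cell z d \<and> s' \<in> cell z d \<and> s \<noteq> s'}. SUP u.
       ennreal (\<P>(w in cond_law G x. conf G w = u \<bar> stratum_of G w = s)) /
       ennreal (\<P>(w in cond_law G x. conf G w = u \<bar> stratum_of G w = s')))"
proof -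
  note K = cond_law_prob[OF G x]
  interpret Q: prob_space "cond_law G x" by (rule K)
  have U: "conf G \<in> cond_law G x \<rightarrow>\<^sub>M count_space UNIV"
    using G C by (simp add: study_model_def measurable_cong_sets[OF K(2) refl])
  have S[measurable]: "stratum_of G \<in> cond_law G x \<rightarrow>\<^sub>M count_space UNIV"
    using stratum_of_measurable[OF G] by (simp add: measurable_cong_sets[OF K(2) refl])
  have ev: "Measurable.pred (cond_law G x) (\<lambda>w. stratum_of G w = s)" for s
    by measurable
  let ?S = "\<lambda>s. {w \<in> space (cond_law G x). stratum_of G w = s}"
  have law: "prob_space (conf_law G s x)" "sets (conf_law G s x) = UNIV"
    "emeasure (conf_law G s x) {u} =
       ennreal (\<P>(w in cond_law G x. conf G w = u \<bar> stratum_of G w = s))"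
    if s: "s \<in> cell z d" for s u
  proof -
    have ne: "emeasure (cond_law G x) (?S s) \<noteq> 0" "emeasure (cond_law G x) (?S s) \<noteq> \<infinity>"
      using pos[OF s] by (auto simp: e_strat_def Q.emeasure_eq_measure)
    interpret R: prob_space "uniform_measure (cond_law G x) (?S s)"
      using ne by (rule prob_space_uniform_measure)
    have U': "conf G \<in> uniform_measure (cond_law G x) (?S s) \<rightarrow>\<^sub>M count_space UNIV"
      using U by (simp add: measurable_cong_sets[OF sets_uniform_measure refl])
    show "prob_space (conf_law G s x)"
      unfolding conf_law_def C by (rule R.prob_space_distr[OF U'])
    show "sets (conf_law G s x) = UNIV" by (simp add: conf_law_def C)
    have "conf G -` {u} \<inter> space (cond_law G x) = {w \<in> space (cond_law G x). conf G w = u}"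
      by auto
    then have "emeasure (conf_law G s x) {u} =
      ennreal (measure (uniform_measure (cond_law G x) (?S s)) {w \<in> space (cond_law G x). conf G w = u})"
      unfolding conf_law_def C
      by (subst emeasure_distr[OF U']) (auto simp only: R.emeasure_eq_measure space_uniform_measure sets_count_space)
    also have "\<dots> = ennreal (\<P>(w in cond_law G x. conf G w = u \<bar> stratum_of G w = s))"
      using Q.measure_uniform_measure_eq_cond_prob[of "\<lambda>w. conf G w = u" "\<lambda>w. stratum_of G w = s"] U ev
      by simp
    finally show "emeasure (conf_law G s x) {u} =
       ennreal (\<P>(w in cond_law G x. conf G w = u \<bar> stratum_of G w = s))" .
  qed
  have nz: "\<not> (\<exists>s\<in>cell z d. e_strat G s x = 0)"
    using pos by force
  show ?thesis
    unfolding RR_SU_def if_not_P[OF nz]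
    by (rule SUP_cong[OF refl]) (auto simp: max_density_ratio_discrete law)
qed

lemma RR_UY_categorical:
  fixes G :: "('a, 'x, 'u::countable) study" and z :: bool
  assumes G: "study_model G" and x: "x \<in> space (cov_space G)"
    and C: "conf_space G = count_space UNIV"
  defines "E \<equiv> \<lambda>u. {w \<in> space (cond_law G x). conf G w = u}"
  defines "M \<equiv> \<lambda>u. \<integral>w. pot_Y G z w \<partial>uniform_measure (cond_law G x) (E u)"
  defines "T \<equiv> {u. measure (cond_law G x) (E u) > 0}"
  shows "RR_UY G z x = (SUP u\<in>T. ennreal (M u)) / (INF u\<in>T. ennreal (M u))"
proof -
  note K = cond_law_prob[OF G x]
  interpret Q: prob_space "cond_law G x" by (rule K)
  have U[measurable]: "conf G \<in> cond_law G x \<rightarrow>\<^sub>M count_space UNIV"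
    using G C by (simp add: study_model_def measurable_cong_sets[OF K(2) refl])
  have Y[measurable]: "pot_Y G z \<in> borel_measurable (cond_law G x)"
    using G by (simp add: study_model_def measurable_cong_sets[OF K(2) refl])
  have "integrable (cond_law G x) (pot_Y G z)"
    using G by (intro Q.integrable_const_bound[where B = 1] AE_I2) (auto simp: study_model_def K)
  then have ae: "AE w in cond_law G x. mean_given_conf G z x w = M (conf G w)"
    unfolding mean_given_conf_def conf_algebra_def C M_def E_def
    by (intro real_cond_exp_discrete K U)
  have pT: "AE w in cond_law G x. conf G w \<in> T"
  proof -
    have "AE w in cond_law G x. \<forall>u. u \<notin> T \<longrightarrow> conf G w \<noteq> u"
      unfolding AE_all_countable
    proof
      fix u
      show "AE w in cond_law G x. u \<notin> T \<longrightarrow> conf G w \<noteq> u"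
      proof (cases "u \<in> T")
        case False
        then have "measure (cond_law G x) (E u) = 0"
          unfolding T_def by (simp add: less_le)
        then have "E u \<in> null_sets (cond_law G x)"
          by (auto simp: null_sets_def Q.emeasure_eq_measure E_def)
        then have "AE w in cond_law G x. w \<notin> E u" by (rule AE_not_in)
        then show ?thesis by (rule AE_mp) (auto simp: E_def)
      qed simp
    qed
    then show ?thesis by eventually_elim auto
  qed
  have at: "P u" if "AE w in cond_law G x. P (conf G w)" "u \<in> T" for P u
  proof (rule ccontr)
    assume "\<not> P u"
    then have "AE w in cond_law G x. w \<notin> E u"
      using that(1) by (auto simp: E_def elim!: eventually_mono)
    then have "measure (cond_law G x) (E u) = 0"
      by (subst Q.prob_eq_0) (auto simp: E_def)
    then show False using that(2) by (simp add: T_def)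
  qed
  let ?f = "\<lambda>w. ennreal (mean_given_conf G z x w)"
  have f: "?f \<in> borel_measurable (cond_law G x)"
    by (simp add: mean_given_conf_def)
  have "esssup (cond_law G x) ?f = (SUP u\<in>T. ennreal (M u))"
  proof (intro antisym SUP_least esssup_I f)
    show "AE w in cond_law G x. ?f w \<le> (SUP u\<in>T. ennreal (M u))"
      using ae pT by eventually_elim (auto intro: SUP_upper)
    have "AE w in cond_law G x. ennreal (M (conf G w)) \<le> esssup (cond_law G x) ?f"
      using ae esssup_AE[where M = "cond_law G x" and f = ?f] by eventually_elim auto
    then show "ennreal (M u) \<le> esssup (cond_law G x) ?f" if "u \<in> T" for u
      using that by (rule at)
  qed
  moreover have "essinf (cond_law G x) ?f = (INF u\<in>T. ennreal (M u))"
    unfolding essinf_eq_AE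
  proof (intro antisym Sup_least INF_greatest Sup_upper; clarify)
    fix y u assume "AE w in cond_law G x. y \<le> ?f w" and u: "u \<in> T"
    from this(1) ae have "AE w in cond_law G x. y \<le> ennreal (M (conf G w))"
      by (rule eventually_elim2) auto
    then show "y \<le> ennreal (M u)" using u by (rule at)
  next
    show "AE w in cond_law G x. (INF u\<in>T. ennreal (M u)) \<le> ?f w"
      using ae pT by eventually_elim (auto intro: INF_lower)
  qed
  ultimately show ?thesis by (simp add: RR_UY_def)
qed

end

theory Submission
  imports Defs
begin

text \<open>The upper bound is the lower bound for the outcome \<open>1 - Y\<close>, so the effect lower bound is a sum
  of two functions of the same shape, each of which is either constant or strictly decreasing.
  As their sum is positive at 1 and nonpositive at the actual bounding factors, it is not constant on
  the diagonal; hence it has a unique zero there, and monotonicity in each argument forces one of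
  the two bounding factors to reach this zero.  What remains is to invert
  \<open>a * b / (a + b - 1) \<ge> \<Lambda>\<close>.\<close>

section \<open>The bounds as functions of the bounding factor\<close>

lemma A_factor_pos:
  assumes "0 \<le> w" "w \<le> 1" "1 \<le> b"
  shows "0 < A_factor w b"
proof -
  have "(1 - w) * 1 \<le> (1 - w) * b" using assms by (intro mult_left_mono) auto
  then show ?thesis by (simp add: A_factor_def)
qed

lemma B_factor_pos:
  assumes "0 \<le> w" "w \<le> 1" "1 \<le> b"
  shows "0 < B_factor w b"
proof (cases "w = 0")
  case False
  then have "0 < w" "0 \<le> (1 - w) / b" using assms by auto
  then show ?thesis unfolding B_factor_def by linarith
qed (use assms in \<open>simp add: B_factor_def\<close>)

text \<open>In a mixture with mean \<open>m\<close>, the first term bounds from below the mean of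
  the component of weight \<open>w\<close> when the other component's mean is at most
  \<open>b\<close> times as large. The second term does so when the component's complement (1 minus
  its mean) is at most \<open>b\<close> times that of the other.\<close>

definition mixture_bd :: "real \<Rightarrow> real \<Rightarrow> real \<Rightarrow> real" where
  "mixture_bd m w b = max (m / A_factor w b) (1 - (1 - m) / B_factor w b)"

lemma lower_bd_eq_mixture_bd:
  "lower_bd G z d s x b = mixture_bd (obs_mean G z d x) (weight G z d s x) b"
  by (simp add: lower_bd_def mixture_bd_def)

text \<open>Complementing the mean turns \<open>min\<close> into 1 minus \<open>max\<close> and
  swaps the roles of the two terms.\<close>

lemma upper_bd_eq_mixture_bd:
  "upper_bd G z d s x b = 1 - mixture_bd (1 - obs_mean G z d x) (weight G z d s x) b"
  by (simp add: upper_bd_def mixture_bd_def min_def max_def)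

lemma mixture_bd_1 [simp]: "mixture_bd m w 1 = m"
  by (simp add: mixture_bd_def A_factor_def B_factor_def)

lemma continuous_on_mixture_bd:
  assumes "0 \<le> w" "w \<le> 1"
  shows "continuous_on {1..} (mixture_bd m w)"
proof -
  have "A_factor w b \<noteq> 0" "B_factor w b \<noteq> 0" "b \<noteq> 0" if "b \<in> {1..}" for b
    using A_factor_pos[of w b] B_factor_pos[of w b] that assms by auto
  then show ?thesis
    unfolding mixture_bd_def[abs_def] A_factor_def B_factor_def
    by (intro continuous_intros) auto
qed

text \<open>Mere antitonicity would allow a flat stretch at the zero of a sum, hence several zeros.
  With this dichotomy a sum of two such functions is again constant or strictly decreasing from 1
  on.\<close>

definition const_or_strict_antimono :: "(real \<Rightarrow> real) \<Rightarrow> bool" where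
  "const_or_strict_antimono g \<longleftrightarrow>
     (\<forall>b\<ge>1. g b = g 1) \<or> (\<forall>b b'. 1 \<le> b \<longrightarrow> b < b' \<longrightarrow> g b' < g b)"

lemma const_or_strict_antimono_mono:
  assumes "const_or_strict_antimono g" "1 \<le> b" "b \<le> b'"
  shows "g b' \<le> g b"
proof (cases "\<forall>b\<ge>1. g b = g 1")
  case True
  then show ?thesis using assms(2,3) by (metis order.trans order.refl)
next
  case False
  then show ?thesis
    using assms unfolding const_or_strict_antimono_def by (cases "b = b'") (auto simp: less_le)
qed

text \<open>If \<open>w < 1\<close> and \<open>m < 1\<close>, both terms under \<open>max\<close>
  fall strictly, as \<open>A_factor\<close> grows and \<open>B_factor\<close> shrinks with
  \<open>b\<close>. If \<open>w = 1\<close>, both factors are 1; if \<open>m = 1\<close>, the second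
  term is 1 and dominates because \<open>A_factor\<close> is at least 1.\<close>

lemma const_or_strict_antimono_mixture_bd:
  assumes "0 < m" "m \<le> 1" "0 \<le> w" "w \<le> 1"
  shows "const_or_strict_antimono (mixture_bd m w)"
proof -
  have const: "mixture_bd m w b = m" if "w = 1 \<or> m = 1" "1 \<le> b" for b
  proof (cases "w = 1")
    case True
    then show ?thesis by (simp add: mixture_bd_def A_factor_def B_factor_def)
  next
    case False
    have "(1 - w) * 1 \<le> (1 - w) * b" using assms that by (intro mult_left_mono) auto
    then have "1 \<le> A_factor w b" by (simp add: A_factor_def)
    with False that show ?thesis by (simp add: mixture_bd_def max_def)
  qed
  have decr: "mixture_bd m w b' < mixture_bd m w b"
    if w: "w < 1" and m: "m < 1" and b: "1 \<le> b" "b < b'" for b b'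
  proof -
    have "A_factor w b < A_factor w b'"
      using w b by (simp add: A_factor_def)
    then have A: "m / A_factor w b' < m / A_factor w b"
      using assms A_factor_pos[of w b] b by (intro divide_strict_left_mono mult_pos_pos) auto
    have "B_factor w b' < B_factor w b"
      using w b by (auto simp: B_factor_def intro!: divide_strict_left_mono)
    then have B: "(1 - m) / B_factor w b < (1 - m) / B_factor w b'"
      using m assms B_factor_pos[of w b] B_factor_pos[of w b'] b
      by (intro divide_strict_left_mono mult_pos_pos) auto
    show ?thesis using A B by (auto simp: mixture_bd_def max_def)
  qed
  show ?thesis
  proof (cases "w = 1 \<or> m = 1")
    case True
    then show ?thesis using const by (simp add: const_or_strict_antimono_def)
  next
    case False
    then show ?thesis using decr assms by (simp add: const_or_strict_antimono_def)
  qed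
qed

lemma ex1_zero_on_diagonal:
  fixes g h :: "real \<Rightarrow> real"
  assumes cont: "continuous_on {1..} g" "continuous_on {1..} h"
    and g: "const_or_strict_antimono g" and h: "const_or_strict_antimono h"
    and start: "c < g 1 + h 1" and b: "1 \<le> b\<^sub>1" "1 \<le> b\<^sub>0" and le: "g b\<^sub>1 + h b\<^sub>0 \<le> c"
  shows "\<exists>!\<Lambda>. 1 < \<Lambda> \<and> g \<Lambda> + h \<Lambda> = c"
    and "\<And>\<Lambda>. 1 < \<Lambda> \<Longrightarrow> g \<Lambda> + h \<Lambda> = c \<Longrightarrow> \<Lambda> \<le> max b\<^sub>1 b\<^sub>0"
proof -
  let ?f = "\<lambda>b. g b + h b" and ?M = "max b\<^sub>1 b\<^sub>0"
  \<comment> \<open>Were both functions constant, \<open>le\<close> would contradict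
    \<open>start\<close>; so one falls strictly while the other does not rise.\<close>
  have decr: "?f b' < ?f b" if "1 \<le> b" "b < b'" for b b'
  proof -
    have "\<not> ((\<forall>b\<ge>1. g b = g 1) \<and> (\<forall>b\<ge>1. h b = h 1))"
    proof
      assume "(\<forall>b\<ge>1. g b = g 1) \<and> (\<forall>b\<ge>1. h b = h 1)"
      then have "g b\<^sub>1 = g 1" "h b\<^sub>0 = h 1" using b by blast+
      then show False using start le by simp
    qed
    then have "g b' < g b \<or> h b' < h b"
      using g h that unfolding const_or_strict_antimono_def by blast
    moreover have "g b' \<le> g b" "h b' \<le> h b"
      using that by (auto intro: const_or_strict_antimono_mono[OF g] const_or_strict_antimono_mono[OF h])
    ultimately show ?thesis by linarith
  qed
  \<comment> \<open>Moving both arguments up to their maximum leads to the diagonal without raising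
    the sum, so the intermediate value theorem applies between 1 and \<open>?M\<close>.\<close>
  have "g ?M \<le> g b\<^sub>1" "h ?M \<le> h b\<^sub>0"
    using b by (auto intro: const_or_strict_antimono_mono[OF g] const_or_strict_antimono_mono[OF h])
  then have M: "?f ?M \<le> c" using le by linarith
  have "continuous_on {1..?M} ?f"
    by (intro continuous_intros continuous_on_subset[OF cont(1)] continuous_on_subset[OF cont(2)]) auto
  then obtain \<Lambda> where \<Lambda>: "1 \<le> \<Lambda>" "?f \<Lambda> = c"
    using IVT2'[of ?f ?M c 1] M start b by (auto simp: le_max_iff_disj)
  with start have "1 < \<Lambda>" by (cases "\<Lambda> = 1") auto
  then show "\<exists>!\<Lambda>. 1 < \<Lambda> \<and> g \<Lambda> + h \<Lambda> = c"
  proof (intro ex1I[of _ \<Lambda>] conjI \<Lambda>(2))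
    fix \<Lambda>' assume "1 < \<Lambda>' \<and> g \<Lambda>' + h \<Lambda>' = c"
    with \<open>1 < \<Lambda>\<close> \<Lambda>(2) show "\<Lambda>' = \<Lambda>"
      using decr[of \<Lambda> \<Lambda>'] decr[of \<Lambda>' \<Lambda>] by (cases \<Lambda> \<Lambda>' rule: linorder_cases) auto
  qed
  show "\<Lambda> \<le> ?M" if "1 < \<Lambda>" "g \<Lambda> + h \<Lambda> = c" for \<Lambda>
  proof (rule ccontr)
    assume "\<not> \<Lambda> \<le> ?M"
    then show False using decr[of ?M \<Lambda>] that M b by (auto simp: le_max_iff_disj)
  qed
qed


section \<open>The bounding factor\<close>

text \<open>This puts the bounding factors in the domain where the bounds are monotone.\<close>

lemma bounding_factor_ge_1:
  fixes a b :: real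
  assumes "1 \<le> a" "1 \<le> b"
  shows "1 \<le> a * b / (a + b - 1)"
proof -
  have "0 \<le> (a - 1) * (b - 1)" using assms by simp
  then show ?thesis using assms by (simp add: le_divide_eq algebra_simps)
qed

text \<open>Clearing the denominator and completing the product gives \<open>(a - \<Lambda>) * (b -
  \<Lambda>) >= \<Lambda> * (\<Lambda> - 1)\<close>. Once the bound on the minimum makes both
  factors nonnegative, the square of the larger one exceeds the right-hand side.\<close>

lemma bounding_factor_min_max:
  fixes a b \<Lambda> :: real
  assumes a: "1 \<le> a" and b: "1 \<le> b" and \<Lambda>: "1 \<le> \<Lambda>" and le: "\<Lambda> \<le> a * b / (a + b - 1)"
  shows "\<Lambda> \<le> min a b" and "\<Lambda> + sqrt (\<Lambda> * (\<Lambda> - 1)) \<le> max a b"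
proof -
  have *: "\<Lambda> * (a + b - 1) \<le> a * b"
    using a b le by (simp add: le_divide_eq)
  have min: "\<Lambda> \<le> u" if "1 \<le> u" "1 \<le> v" "\<Lambda> * (u + v - 1) \<le> u * v" for u v :: real
  proof -
    \<comment> \<open>From \<open>u >= 1\<close> follows \<open>v <= u + v - 1\<close>; the common
      positive factor \<open>u + v - 1\<close> can then be cancelled.\<close>
    have "u * v \<le> u * (u + v - 1)" using that by (intro mult_left_mono) auto
    then have "\<Lambda> * (u + v - 1) \<le> u * (u + v - 1)" using that(3) by linarith
    then show ?thesis using that(1,2) by (simp add: mult_le_cancel_right)
  qed
  show m: "\<Lambda> \<le> min a b"
    using min[of a b] min[of b a] * a b by (simp add: algebra_simps)
  let ?M = "max a b"
  have "\<Lambda> * (\<Lambda> - 1) \<le> (a - \<Lambda>) * (b - \<Lambda>)"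
    using * by (simp add: algebra_simps)
  also have "\<dots> \<le> (?M - \<Lambda>) * (?M - \<Lambda>)"
    using m by (intro mult_mono) auto
  finally have "sqrt (\<Lambda> * (\<Lambda> - 1)) \<le> ?M - \<Lambda>"
    using m by (intro real_le_lsqrt) (auto simp: power2_eq_square)
  then show "\<Lambda> + sqrt (\<Lambda> * (\<Lambda> - 1)) \<le> ?M" by simp
qed


section \<open>Ranges of the observed means and weights\<close>

lemma (in prob_space) integral_uniform_measure_bounds:
  fixes f :: "'a \<Rightarrow> real"
  assumes A: "A \<in> events" and f: "\<And>w. w \<in> space M \<Longrightarrow> 0 \<le> f w \<and> f w \<le> 1"
  shows "0 \<le> (\<integral>w. f w \<partial>uniform_measure M A)" "(\<integral>w. f w \<partial>uniform_measure M A) \<le> 1"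
proof -
  let ?U = "uniform_measure M A"
  show "0 \<le> (\<integral>w. f w \<partial>?U)"
    using f by (intro integral_nonneg_AE AE_I2) auto
  show "(\<integral>w. f w \<partial>?U) \<le> 1"
  proof (cases "integrable ?U f")
    case int: True
    show ?thesis
    proof (cases "emeasure M A = 0")
      case True
      \<comment> \<open>Conditioning on a null event yields the zero measure, since 0/0 = 0, and the
        integral is 0.\<close>
      then have "emeasure ?U (space ?U) = 0"
        using A by (simp add: emeasure_uniform_measure Int_absorb2 sets.sets_into_space)
      then have "AE w in ?U. False"
        by (intro AE_I[of _ _ "space ?U"]) auto
      then have "AE w in ?U. f w = 0" by (rule AE_mp) simp
      then have "(\<integral>w. f w \<partial>?U) = 0" by (rule integral_eq_zero_AE)
      then show ?thesis by simp
    next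
      case False
      then interpret U: prob_space ?U
        by (intro prob_space_uniform_measure) auto
      show ?thesis
        using f by (intro U.integral_le_const int AE_I2) auto
    qed
  qed (simp add: not_integrable_integral_eq)
qed

lemma obs_mean_bounds:
  assumes G: "study_model G" and x: "x \<in> space (cov_space G)"
  shows "0 \<le> obs_mean G z d x" "obs_mean G z d x \<le> 1"
proof -
  note K = cond_law_prob[OF G x]
  interpret Q: prob_space "cond_law G x" by (rule K)
  have [measurable]: "treat G \<in> cond_law G x \<rightarrow>\<^sub>M count_space UNIV"
    "pot_D G z' \<in> cond_law G x \<rightarrow>\<^sub>M count_space UNIV" for z'
    using G by (auto simp: study_model_def measurable_cong_sets[OF K(2) refl])
  have "{w \<in> space (cond_law G x). treat G w = z \<and> obs_D G w = d} \<in> Q.events"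
    unfolding obs_D_def by measurable
  moreover have "0 \<le> obs_Y G w \<and> obs_Y G w \<le> 1" if "w \<in> space (cond_law G x)" for w
    using G that by (simp add: obs_Y_def study_model_def K)
  ultimately show "0 \<le> obs_mean G z d x" "obs_mean G z d x \<le> 1"
    unfolding obs_mean_def by (auto intro!: Q.integral_uniform_measure_bounds)
qed

text \<open>The case \<open>p_arm G z x = 0\<close> includes treatment arms of probability 0.\<close>

lemma p_arm_eq_pot_D:
  assumes G: "study_model G" and x: "x \<in> space (cov_space G)"
    and ign: "treatment_ignorability G x"
  shows "p_arm G z x = 0 \<or> p_arm G z x = \<P>(w in cond_law G x. pot_D G z w)"
proof -
  note K = cond_law_prob[OF G x]
  interpret Q: prob_space "cond_law G x" by (rule K)
  let ?S = "space (cond_law G x)"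
  let ?E = "{w \<in> ?S. treat G w = z}" and ?F = "{w \<in> ?S. pot_D G z w}"
  let ?T = "vimage_algebra ?S (treat G) (count_space UNIV)"
  let ?h = "\<lambda>w. (pot_D G False w, pot_D G True w, pot_Y G False w, pot_Y G True w)"
  let ?N = "count_space UNIV \<Otimes>\<^sub>M count_space UNIV \<Otimes>\<^sub>M borel \<Otimes>\<^sub>M borel"
  let ?P = "vimage_algebra ?S ?h (?N :: (bool \<times> bool \<times> real \<times> real) measure)"
  have "treat G -` {z} \<inter> ?S \<in> sets ?T"
    by (rule in_vimage_algebra) simp
  moreover have "treat G -` {z} \<inter> ?S = ?E" by auto
  ultimately have E: "?E \<in> sets ?T" by simp
  have "?h \<in> ?P \<rightarrow>\<^sub>M ?N"
    by (intro measurable_vimage_algebra1) (auto simp: space_pair_measure)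
  then have h: "(\<lambda>w. fst (?h w)) \<in> ?P \<rightarrow>\<^sub>M count_space UNIV"
    "(\<lambda>w. fst (snd (?h w))) \<in> ?P \<rightarrow>\<^sub>M count_space UNIV"
    by (auto intro: measurable_compose[OF _ measurable_fst] measurable_compose[OF _ measurable_snd])
  have "pot_D G z \<in> ?P \<rightarrow>\<^sub>M count_space UNIV"
    using h by (cases z) auto
  then have "{w \<in> space ?P. pot_D G z w} \<in> sets ?P"
    by measurable
  then have F: "?F \<in> sets ?P" by simp
  \<comment> \<open>On \<open>?E\<close> the observed \<open>D\<close> is \<open>pot_D G z\<close>,
    so \<open>p_arm\<close> is this product divided by \<open>Q.prob ?E\<close>. That factor cancels
    unless it is 0, when the quotient is 0.\<close>
  have "Q.prob (?E \<inter> ?F) = Q.prob ?E * Q.prob ?F"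
    using ign E F unfolding treatment_ignorability_def by (intro Q.indep_setD)
  moreover have "?E \<inter> ?F = {w \<in> ?S. obs_D G w \<and> treat G w = z}"
    by (auto simp: obs_D_def)
  ultimately show ?thesis
    by (simp add: p_arm_def cond_prob_def)
qed

text \<open>By ignorability the denominator is the probability of \<open>pot_D G z w = d\<close>, an
  event containing the stratum, unless \<open>p_arm\<close> is 0.\<close>

lemma weight_bounds:
  assumes G: "study_model G" and x: "x \<in> space (cov_space G)"
    and ign: "treatment_ignorability G x" and s: "s \<in> cell z d"
  shows "0 \<le> weight G z d s x" "weight G z d s x \<le> 1"
proof -
  note K = cond_law_prob[OF G x]
  interpret Q: prob_space "cond_law G x" by (rule K)
  have [measurable]: "pot_D G z' \<in> cond_law G x \<rightarrow>\<^sub>M count_space UNIV" for z'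
    using G by (auto simp: study_model_def measurable_cong_sets[OF K(2) refl])
  have e: "0 \<le> e_strat G s x" "e_strat G s x \<le> 1"
    by (simp_all add: e_strat_def)
  have "e_strat G s x \<le> \<P>(w in cond_law G x. pot_D G z w = d)"
    using s unfolding e_strat_def mem_cell_iff stratum_of_def
    by (intro Q.finite_measure_mono) (auto split: if_splits)
  also have "\<dots> = (if d then \<P>(w in cond_law G x. pot_D G z w)
      else 1 - \<P>(w in cond_law G x. pot_D G z w))"
    by (cases d) (simp_all add: Q.prob_neg)
  finally have le: "e_strat G s x \<le> \<dots>" .
  have "0 \<le> weight G z d s x \<and> weight G z d s x \<le> 1"
    using p_arm_eq_pot_D[OF G x ign, of z]
  proof
    \<comment> \<open>The weight is then 0 for \<open>d = True\<close>, by division by 0, and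
      \<open>e_strat G s x\<close> for \<open>d = False\<close>.\<close>
    assume "p_arm G z x = 0"
    then show ?thesis using e by (simp add: weight_def)
  next
    assume "p_arm G z x = \<P>(w in cond_law G x. pot_D G z w)"
    then show ?thesis
      using e le by (auto simp: weight_def divide_le_eq_1 split: if_splits)
  qed
  then show "0 \<le> weight G z d s x" "weight G z d s x \<le> 1" by auto
qed

theorem theorem2:
  fixes G :: "('a, 'x, 'u) study" and \<theta> :: "'x \<Rightarrow> ennreal" and x :: 'x
    and s :: stratum and d :: "bool \<Rightarrow> bool" and l :: real
  assumes "study_model G"
    and "x \<in> space (cov_space G)"
    and "treatment_ignorability G x"
    and "latent_principal_ignorability G x"
    and "odds_ratio_assumption G \<theta> x"
    and "\<And>z. s \<in> cell z (d z)"
    and "\<And>z. 1 \<le> RR_SU G z (d z) x \<and> RR_SU G z (d z) x < \<infinity>"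
    and "\<And>z. 1 \<le> RR_UY G z x \<and> RR_UY G z x < \<infinity>"
    and "0 < obs_mean G True (d True) x - obs_mean G False (d False) x"
    and "((\<lambda>\<Lambda>. effect_lower_bd G d s x \<Lambda> \<Lambda>) \<longlongrightarrow> l) at_top"
    and "l \<le> 0"
    and "effect_lower_bd G d s x (BF G True (d True) x) (BF G False (d False) x) \<le> 0"
  shows "(\<exists>!\<Lambda>. is_threshold G d s x \<Lambda>) \<and>
    (\<exists>z. min (RR_SU G z (d z) x) (RR_UY G z x) \<ge> ennreal (threshold G d s x) \<and>
         max (RR_SU G z (d z) x) (RR_UY G z x) \<ge>
           ennreal (threshold G d s x + sqrt (threshold G d s x * (threshold G d s x - 1))))"
proof -
  note G = assms(1) and x = assms(2) and ign = assms(3) and cell = assms(6)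
  define g where "g = mixture_bd (obs_mean G True (d True) x) (weight G True (d True) s x)"
  define h where "h = mixture_bd (1 - obs_mean G False (d False) x) (weight G False (d False) s x)"
  \<comment> \<open>The complement in the upper bound contributes the constant, so nullifying the
    effect means that the sum of \<open>g\<close> and \<open>h\<close> reaches level 1.\<close>
  have eff: "effect_lower_bd G d s x b b' = g b + h b' - 1" for b b'
    by (simp add: effect_lower_bd_def lower_bd_eq_mixture_bd upper_bd_eq_mixture_bd g_def h_def)
  note m = obs_mean_bounds[OF G x] and w = weight_bounds[OF G x ign cell]
  have cont: "continuous_on {1..} g" "continuous_on {1..} h"
    unfolding g_def h_def by (intro continuous_on_mixture_bd w)+
  have gh: "const_or_strict_antimono g" "const_or_strict_antimono h"
    unfolding g_def h_def
    \<comment> \<open>A positive difference of two means in [0, 1] makes the treated mean positive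
      and the control mean less than 1.\<close>
    using m[of True "d True"] m[of False "d False"] assms(9)
    by (auto intro!: const_or_strict_antimono_mixture_bd w)
  have start: "1 < g 1 + h 1"
    using assms(9) by (simp add: g_def h_def)
  define a where "a z = enn2real (RR_SU G z (d z) x)" for z
  define c where "c z = enn2real (RR_UY G z x)" for z
  \<comment> \<open>Finiteness of the parameters makes the passage to reals lossless.\<close>
  have a: "RR_SU G z (d z) x = ennreal (a z)" "1 \<le> a z" for z
    using assms(7)[of z] enn2real_mono[of 1 "RR_SU G z (d z) x"] by (auto simp: a_def)
  have c: "RR_UY G z x = ennreal (c z)" "1 \<le> c z" for z
    using assms(8)[of z] enn2real_mono[of 1 "RR_UY G z x"] by (auto simp: c_def)
  have BF: "BF G z (d z) x = a z * c z / (a z + c z - 1)" for z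
    by (simp add: BF_def a_def c_def)
  have BF_ge_1: "1 \<le> BF G z (d z) x" for z
    unfolding BF by (intro bounding_factor_ge_1 a c)
  have le: "g (BF G True (d True) x) + h (BF G False (d False) x) \<le> 1"
    using assms(12) by (simp add: eff)
  note zero = ex1_zero_on_diagonal[OF cont gh start BF_ge_1 BF_ge_1 le]
  have thr: "is_threshold G d s x \<Lambda> \<longleftrightarrow> 1 < \<Lambda> \<and> g \<Lambda> + h \<Lambda> = 1" for \<Lambda>
    by (auto simp: is_threshold_def eff)
  have ex1: "\<exists>!\<Lambda>. is_threshold G d s x \<Lambda>"
    using zero(1) by (simp add: thr)
  define \<Lambda> where "\<Lambda> = threshold G d s x"
  have "is_threshold G d s x \<Lambda>"
    unfolding \<Lambda>_def threshold_def using ex1 by (rule theI')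
  then have \<Lambda>: "1 < \<Lambda>" "g \<Lambda> + h \<Lambda> = 1" by (auto simp: thr)
  have "\<Lambda> \<le> max (BF G True (d True) x) (BF G False (d False) x)"
    using \<Lambda> by (rule zero(2))
  then obtain z where z: "\<Lambda> \<le> BF G z (d z) x"
    by (auto simp: le_max_iff_disj)
  have "\<Lambda> \<le> min (a z) (c z)" "\<Lambda> + sqrt (\<Lambda> * (\<Lambda> - 1)) \<le> max (a z) (c z)"
    using \<Lambda>(1) z by (auto intro!: bounding_factor_min_max a c simp: BF simp del: min.bounded_iff)
  then have "ennreal \<Lambda> \<le> min (ennreal (a z)) (ennreal (c z))"
    "ennreal (\<Lambda> + sqrt (\<Lambda> * (\<Lambda> - 1))) \<le> max (ennreal (a z)) (ennreal (c z))"
    by (auto simp: le_max_iff_disj intro: ennreal_leI)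
  with ex1 show ?thesis
    unfolding \<Lambda>_def a(1) c(1) by blast
qed

end
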